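(* Let $m>0$, let $g\in\mathbb{R}$ with $|g|>2m$, and let $L\ge2$ be an integer. For $\epsilon\in\mathbb{R}$, consider the nonlinear Su-Schrieffer-Heeger chain with $L$ unit cells, intra-cell hopping $m$ and inter-cell hopping $\epsilon$, as defined in the context. Suppose that for $\epsilon$ in a neighbourhood of $0$ there is a family of real normalized breathers $\phi(\epsilon)$ with frequencies $\omega(\epsilon)$, continuous in $\epsilon$, such that at $\epsilon=0$ the breather is supported in a single unit cell $R_0$, $\phi(0)_{(R,\alpha)}=\delta_{R,R_0}\phi_\alpha$, with $\phi_A^2+\phi_B^2=1$, $\phi_A\phi_B=-m/g$ and $\omega(0)=g$. Then there exists $r>0$ such that the breather $\phi(\epsilon)$ is linearly stable for all $|\epsilon|<r$.
   Context: Sites are labelled $a=(R,\alpha)$ with $R\in\mathbb{Z}/L\mathbb{Z}$ and $\alpha\in\{A,B\}$. The hopping matrix $h=h(\epsilon)$ is the real symmetric matrix with $h_{(R,A),(R',A)}=h_{(R,B),(R',B)}=0$, $h_{(R,A),(R',B)}=-m\delta_{R,R'}-\epsilon\delta_{R+1,R'}$ and $h_{(R,B),(R',A)}=-m\delta_{R,R'}-\epsilon\delta_{R-1,R'}$. A real normalized breather with frequency $\omega\in\mathbb{R}$ is a real vector $\phi=(\phi_a)$ with $\sum_a\phi_a^2=1$ and $\sum_bh_{ab}\phi_b+g\phi_a^3=\omega\phi_a$ for all $a$. Its stability matrix is the real $4L\times 4L$ matrix $$J\mathcal{L}=\begin{pmatrix}0&-\mathcal{L}_+\\ \mathcal{L}_-&0\end{pmatrix},\qquad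 (\mathcal{L}_\pm)_{ab}=h_{ab}-\omega\delta_{ab}+(2\pm1)g\phi_a^2\delta_{ab}.$$ The breather is called linearly stable if all eigenvalues of $J\mathcal{L}$ lie on the imaginary axis. *)

theory Defs
  imports "HOL-Analysis.Analysis" "Berlekamp_Zassenhaus.Finite_Field"
begin

text \<open>
  The number of unit cells is \<open>L = CARD('l)\<close>, where the type \<open>'l\<close> of class \<open>nontriv\<close>
  ranges over the finite types with at least two elements, and \<open>'l mod_ring\<close> is the
  ring of integers modulo \<open>L\<close>.
\<close>

datatype sublattice = SubA | SubB

lemma UNIV_sublattice: "(UNIV :: sublattice set) = {SubA, SubB}"
  using sublattice.exhaust by blast

instance sublattice :: finite
  by standard (simp add: UNIV_sublattice)

type_synonym 'l site = "'l mod_ring \<times> sublattice"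

definition hopping :: "real \<Rightarrow> real \<Rightarrow> real ^ ('l::nontriv) site ^ 'l site" where
  "hopping m \<epsilon> = (\<chi> a b. case (a, b) of
       ((R, SubA), (R', SubB)) \<Rightarrow> - m * of_bool (R = R') - \<epsilon> * of_bool (R + 1 = R')
     | ((R, SubB), (R', SubA)) \<Rightarrow> - m * of_bool (R = R') - \<epsilon> * of_bool (R - 1 = R')
     | _ \<Rightarrow> 0)"

definition normalized_breather ::
  "real \<Rightarrow> real \<Rightarrow> real \<Rightarrow> real \<Rightarrow> real ^ ('l::nontriv) site \<Rightarrow> bool" where
  "normalized_breather m \<epsilon> g \<omega> \<phi> \<longleftrightarrow>
     (\<Sum>a\<in>UNIV. (\<phi> $ a)^2) = 1 \<and>
     (\<forall>a. (\<Sum>b\<in>UNIV. hopping m \<epsilon> $ a $ b * \<phi> $ b) + g * (\<phi> $ a)^3 = \<omega> * \<phi> $ a)"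

text \<open>The operators \<open>\<L>\<^sub>+\<close> and \<open>\<L>\<^sub>-\<close> are obtained for \<open>\<sigma> = 1\<close> and \<open>\<sigma> = -1\<close>, respectively.\<close>

definition stability_op ::
  "real \<Rightarrow> real \<Rightarrow> real \<Rightarrow> real \<Rightarrow> real \<Rightarrow> real ^ ('l::nontriv) site
     \<Rightarrow> real ^ 'l site ^ 'l site" where
  "stability_op \<sigma> m \<epsilon> g \<omega> \<phi> = (\<chi> a b. hopping m \<epsilon> $ a $ b - \<omega> * of_bool (a = b)
     + (2 + \<sigma>) * g * (\<phi> $ a)^2 * of_bool (a = b))"

definition stability_matrix ::
  "real \<Rightarrow> real \<Rightarrow> real \<Rightarrow> real \<Rightarrow> real ^ ('l::nontriv) site
     \<Rightarrow> real ^ ('l site + 'l site) ^ ('l site + 'l site)" where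
  "stability_matrix m \<epsilon> g \<omega> \<phi> = (\<chi> i j. case (i, j) of
       (Inl a, Inr b) \<Rightarrow> - (stability_op 1 m \<epsilon> g \<omega> \<phi> $ a $ b)
     | (Inr a, Inl b) \<Rightarrow> stability_op (-1) m \<epsilon> g \<omega> \<phi> $ a $ b
     | _ \<Rightarrow> 0)"

definition eigenvalue :: "'a::field ^ 'n ^ 'n \<Rightarrow> 'a \<Rightarrow> bool" where
  "eigenvalue M k \<longleftrightarrow> (\<exists>v. v \<noteq> 0 \<and> M *v v = k *s v)"

text \<open>The eigenvalues of the real stability matrix are its complex ones.\<close>

definition linearly_stable ::
  "real \<Rightarrow> real \<Rightarrow> real \<Rightarrow> real \<Rightarrow> real ^ ('l::nontriv) site \<Rightarrow> bool" where
  "linearly_stable m \<epsilon> g \<omega> \<phi> \<longleftrightarrow>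
     (\<forall>k. eigenvalue (\<chi> i j. complex_of_real (stability_matrix m \<epsilon> g \<omega> \<phi> $ i $ j)) k
        \<longrightarrow> Re k = 0)"

end

theory Submission
  imports Defs
begin

text \<open>
  Gauge invariance makes \<open>\<phi>\<close> a null vector of \<open>\<L>\<^sub>-\<close> for every \<open>\<epsilon>\<close>. At \<open>\<epsilon> = 0\<close> both \<open>- g \<L>\<^sub>\<plusminus>\<close> are
  positive definite on the orthogonal complement of \<open>\<phi>\<close>: the empty cells contribute
  \<open>g\<^sup>2 \<plusminus> g m > 0\<close>, and the occupied cell contributes \<open>g\<^sup>2\<close> for \<open>\<L>\<^sub>-\<close> and \<open>g\<^sup>2 - 4 m\<^sup>2\<close> for \<open>\<L>\<^sub>+\<close>.
  By compactness of the unit sphere this persists for small \<open>\<epsilon>\<close>. If now \<open>(u, w)\<close> is an eigenvector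
  with eigenvalue \<open>k \<noteq> 0\<close>, then \<open>w\<close> lies in the range of \<open>\<L>\<^sub>-\<close>, so \<open>w\<close> is orthogonal to \<open>\<phi>\<close>, and with
  \<open>z = \<langle>u, w\<rangle>\<close> the real numbers \<open>p = \<langle>u, \<L>\<^sub>- u\<rangle> = k z\<close> and \<open>q = \<langle>w, \<L>\<^sub>+ w\<rangle> = - k cnj z\<close> satisfy
  \<open>k\<^sup>2 \<bar>z\<bar>\<^sup>2 = - p q \<le> 0\<close>, which forces \<open>k\<close> to be imaginary.
\<close>

section \<open>Quadratic forms that are positive on a hyperplane\<close>

definition quad :: "real ^ 'n ^ 'n \<Rightarrow> real ^ 'n \<Rightarrow> real" where
  "quad M x = x \<bullet> (M *v x)"

lemma quad_scaleR: "quad M (c *\<^sub>R x) = c\<^sup>2 * quad M x"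
  by (simp add: quad_def matrix_vector_mult_scaleR power2_eq_square)

text \<open>The hyperplane moves with \<epsilon> together with the form. Counterexamples at
  parameters tending to 0 can be taken of unit norm, so a subsequence converges to a unit vector
  orthogonal to \<open>\<phi> 0\<close> on which the limiting form is nonpositive.\<close>

lemma posdef_orthogonal_compl_eventually:
  fixes M :: "real \<Rightarrow> real ^ 'n ^ 'n" and \<phi> :: "real \<Rightarrow> real ^ 'n"
  assumes M: "isCont M 0" and \<phi>: "isCont \<phi> 0"
    and pos: "\<And>x. x \<noteq> 0 \<Longrightarrow> x \<bullet> \<phi> 0 = 0 \<Longrightarrow> quad (M 0) x > 0"
  shows "\<exists>r>0. \<forall>\<epsilon>. \<bar>\<epsilon>\<bar> < r \<longrightarrow> (\<forall>x. x \<noteq> 0 \<longrightarrow> x \<bullet> \<phi> \<epsilon> = 0 \<longrightarrow> quad (M \<epsilon>) x > 0)"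
proof (rule ccontr)
  assume "\<not> ?thesis"
  then have *: "\<exists>\<epsilon> x. \<bar>\<epsilon>\<bar> < r \<and> x \<noteq> 0 \<and> x \<bullet> \<phi> \<epsilon> = 0 \<and> quad (M \<epsilon>) x \<le> 0" if "r > 0" for r
    using that by (meson not_less)
  \<comment> \<open>Rescaling to unit norm preserves both orthogonality and the sign of the form,
    and it moves the vectors into a compact set.\<close>
  have "\<exists>\<epsilon> x. \<bar>\<epsilon>\<bar> < inverse (real (Suc n)) \<and> norm x = 1 \<and> x \<bullet> \<phi> \<epsilon> = 0 \<and> quad (M \<epsilon>) x \<le> 0" for n
  proof -
    obtain \<epsilon> x where e: "\<bar>\<epsilon>\<bar> < inverse (real (Suc n))" and x: "x \<noteq> 0" "x \<bullet> \<phi> \<epsilon> = 0" "quad (M \<epsilon>) x \<le> 0"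
      using *[of "inverse (real (Suc n))"] by auto
    have "norm ((1 / norm x) *\<^sub>R x) = 1" "((1 / norm x) *\<^sub>R x) \<bullet> \<phi> \<epsilon> = 0"
      using x by auto
    moreover have "quad (M \<epsilon>) ((1 / norm x) *\<^sub>R x) \<le> 0"
      unfolding quad_scaleR using x(3) by (simp add: mult_nonneg_nonpos divide_nonpos_nonneg)
    ultimately show ?thesis using e by blast
  qed
  then obtain \<epsilon> x where e: "\<And>n. \<bar>\<epsilon> n\<bar> < inverse (real (Suc n))" and x1: "\<And>n. norm (x n) = 1"
    and x2: "\<And>n. x n \<bullet> \<phi> (\<epsilon> n) = 0" and x3: "\<And>n. quad (M (\<epsilon> n)) (x n) \<le> 0"
    by metis
  have e0: "\<epsilon> \<longlonglongrightarrow> 0"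
    by (rule Lim_null_comparison[OF _ LIMSEQ_inverse_real_of_nat]) (use e in \<open>auto intro: less_imp_le always_eventually\<close>)
  have "\<forall>n. x n \<in> sphere 0 1" using x1 by simp
  then obtain l s where l: "l \<in> sphere 0 1" and s: "strict_mono s" "(x \<circ> s) \<longlonglongrightarrow> l"
    using compact_sphere[unfolded compact_def] by metis
  have es: "(\<lambda>n. \<epsilon> (s n)) \<longlonglongrightarrow> 0"
    using LIMSEQ_subseq_LIMSEQ[OF e0 s(1)] by (simp add: o_def)
  have xs: "(\<lambda>n. x (s n)) \<longlonglongrightarrow> l" using s(2) by (simp add: o_def)
  have Ms: "(\<lambda>n. M (\<epsilon> (s n))) \<longlonglongrightarrow> M 0" and \<phi>s: "(\<lambda>n. \<phi> (\<epsilon> (s n))) \<longlonglongrightarrow> \<phi> 0"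
    using isCont_tendsto_compose[OF M es] isCont_tendsto_compose[OF \<phi> es] by auto
  have "(\<lambda>n. M (\<epsilon> (s n)) *v x (s n)) \<longlonglongrightarrow> M 0 *v l"
    unfolding matrix_vector_mult_def
    by (intro vec_tendstoI) (simp, intro tendsto_intros tendsto_vec_nth Ms xs)
  then have "(\<lambda>n. quad (M (\<epsilon> (s n))) (x (s n))) \<longlonglongrightarrow> quad (M 0) l"
    unfolding quad_def by (intro tendsto_inner xs)
  then have "quad (M 0) l \<le> 0"
    by (rule LIMSEQ_le_const2) (use x3 in auto)
  moreover have "(\<lambda>n. x (s n) \<bullet> \<phi> (\<epsilon> (s n))) \<longlonglongrightarrow> l \<bullet> \<phi> 0"
    by (intro tendsto_inner xs \<phi>s)
  then have "l \<bullet> \<phi> 0 = 0" using x2 LIMSEQ_unique[OF _ tendsto_const] by simp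
  ultimately show False using pos[of l] l by force
qed

lemma symmetric_inner:
  fixes M :: "real ^ 'n ^ 'n"
  assumes "transpose M = M"
  shows "x \<bullet> (M *v y) = (M *v x) \<bullet> y"
  using assms dot_lmul_matrix[of x M y] transpose_matrix_vector[of M x] by simp

text \<open>Removing the component of \<open>x\<close> along \<open>f\<close> leaves
  \<open>M *v x\<close> unchanged and, by symmetry, also the value of the form. Positivity on the
  hyperplane thus yields semidefiniteness on the whole space.\<close>

lemma quad_nonneg_of_null_vector:
  fixes M :: "real ^ 'n ^ 'n"
  assumes sym: "transpose M = M" and null: "M *v f = 0" and f: "f \<noteq> 0"
    and pos: "\<And>x. x \<noteq> 0 \<Longrightarrow> x \<bullet> f = 0 \<Longrightarrow> quad M x > 0"
  shows "quad M x \<ge> 0"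
proof -
  define c where "c = (x \<bullet> f) / (f \<bullet> f)"
  define y where "y = x - c *\<^sub>R f"
  have y: "y \<bullet> f = 0" using f by (simp add: y_def c_def inner_diff_left)
  have x: "x = y + c *\<^sub>R f" by (simp add: y_def)
  have Mx: "M *v x = M *v y"
    unfolding x matrix_vector_mult_add_rdistrib[symmetric]
    by (simp add: matrix_vector_right_distrib matrix_vector_mult_scaleR null)
  have "quad M x = x \<bullet> (M *v y)" unfolding quad_def Mx ..
  also have "\<dots> = (M *v y) \<bullet> y" unfolding symmetric_inner[OF sym] Mx ..
  also have "\<dots> = quad M y" by (simp add: quad_def inner_commute)
  finally show ?thesis using pos[OF _ y] by (cases "y = 0") (auto simp: quad_def)
qed

section \<open>Complex vectors and real symmetric matrices\<close>

definition herm :: "complex ^ 'n \<Rightarrow> complex ^ 'n \<Rightarrow> complex" where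
  "herm x y = (\<Sum>a\<in>UNIV. cnj (x $ a) * y $ a)"

lemma cnj_herm: "cnj (herm x y) = herm y x"
  by (simp add: herm_def mult.commute)

lemma herm_smult_right: "herm x (k *s y) = k * herm x y"
  by (simp add: herm_def sum_distrib_left algebra_simps)

abbreviation "cmat M \<equiv> \<chi> i j. complex_of_real (M $ i $ j)"
abbreviation "Revec x \<equiv> \<chi> a. Re (x $ a)"
abbreviation "Imvec x \<equiv> \<chi> a. Im (x $ a)"

lemma Revec_cmat: "Revec (cmat M *v x) = M *v Revec x"
  and Imvec_cmat: "Imvec (cmat M *v x) = M *v Imvec x"
  by (simp_all add: vec_eq_iff matrix_vector_mult_def)

text \<open>Symmetry cancels the cross terms between real and imaginary parts. This lets positivity
  known for real vectors act on complex eigenvectors.\<close>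

lemma herm_cmat_symmetric:
  fixes M :: "real ^ 'n ^ 'n"
  assumes "transpose M = M"
  shows "herm x (cmat M *v x) = complex_of_real (quad M (Revec x) + quad M (Imvec x))"
proof (rule complex_eqI)
  have "Re (herm x (cmat M *v x)) = Revec x \<bullet> Revec (cmat M *v x) + Imvec x \<bullet> Imvec (cmat M *v x)"
    by (simp add: herm_def inner_vec_def sum.distrib)
  then show "Re (herm x (cmat M *v x)) = Re (complex_of_real (quad M (Revec x) + quad M (Imvec x)))"
    by (simp add: quad_def Revec_cmat Imvec_cmat)
  have "Im (herm x (cmat M *v x)) = Revec x \<bullet> Imvec (cmat M *v x) - Imvec x \<bullet> Revec (cmat M *v x)"
    by (simp add: herm_def inner_vec_def sum_subtractf)
  also have "\<dots> = 0"
    unfolding Revec_cmat Imvec_cmat symmetric_inner[OF assms, of "Revec x"]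
    by (simp add: inner_commute)
  finally show "Im (herm x (cmat M *v x)) = Im (complex_of_real (quad M (Revec x) + quad M (Imvec x)))"
    by simp
qed

section \<open>From definiteness to imaginary eigenvalues\<close>

lemma Re_eq_0_if_square_nonpos:
  assumes "k\<^sup>2 = complex_of_real t" "t \<le> 0"
  shows "Re k = 0"
proof -
  have "(Re k)\<^sup>2 - (Im k)\<^sup>2 = Re (k\<^sup>2)" "2 * Re k * Im k = Im (k\<^sup>2)"
    by (simp_all add: power2_eq_square)
  then have k: "(Re k)\<^sup>2 - (Im k)\<^sup>2 = t" "Re k * Im k = 0"
    unfolding assms(1) by simp_all
  show ?thesis
  proof (rule ccontr)
    assume "Re k \<noteq> 0"
    then have "(Re k)\<^sup>2 = t" "(Re k)\<^sup>2 > 0" using k by auto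
    then show False using assms(2) by linarith
  qed
qed

text \<open>The coupled equations say that \<open>(u, w)\<close> is an eigenvector of \<open>J\<L>\<close>.\<close>

lemma Re_eigenvalue_eq_0:
  fixes P Q :: "real ^ 'n ^ 'n" and u w :: "complex ^ 'n"
  assumes symP: "transpose P = P" and symQ: "transpose Q = Q"
    and null: "P *v f = 0" and f: "f \<noteq> 0" and c: "c \<noteq> 0"
    and posP: "\<And>x. x \<noteq> 0 \<Longrightarrow> x \<bullet> f = 0 \<Longrightarrow> quad (c *\<^sub>R P) x > 0"
    and posQ: "\<And>x. x \<noteq> 0 \<Longrightarrow> x \<bullet> f = 0 \<Longrightarrow> quad (c *\<^sub>R Q) x > 0"
    and eqP: "cmat P *v u = k *s w" and eqQ: "cmat Q *v w = (- k) *s u"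
    and nz: "u \<noteq> 0 \<or> w \<noteq> 0"
  shows "Re k = 0"
proof (cases "k = 0")
  case False
  have quad_c: "quad (c *\<^sub>R M) x = c * quad M x" for M :: "real ^ 'n ^ 'n" and x
    by (simp add: quad_def scaleR_matrix_vector_assoc[symmetric])
  define z where "z = herm u w"
  define p where "p = quad P (Revec u) + quad P (Imvec u)"
  define q where "q = quad Q (Revec w) + quad Q (Imvec w)"
  have p: "complex_of_real p = k * z"
    unfolding p_def herm_cmat_symmetric[OF symP, symmetric] eqP herm_smult_right z_def ..
  have q: "complex_of_real q = - k * cnj z"
    unfolding q_def herm_cmat_symmetric[OF symQ, symmetric] eqQ herm_smult_right z_def cnj_herm ..
  \<comment> \<open>Since \<open>u\<close> may have a component along \<open>f\<close>, only
    semidefiniteness is available for \<open>c * p\<close>.\<close>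
  have "transpose (c *\<^sub>R P) = c *\<^sub>R P" "(c *\<^sub>R P) *v f = 0"
    using symP null by (simp_all add: transpose_def vec_eq_iff scaleR_matrix_vector_assoc[symmetric])
  from quad_nonneg_of_null_vector[OF this f posP]
  have cp: "c * p \<ge> 0" unfolding p_def distrib_left quad_c[symmetric] by (simp add: add_nonneg_nonneg)
  have range_orth: "(P *v y) \<bullet> f = 0" for y
    using symmetric_inner[OF symP, of y f] null by simp
  \<comment> \<open>By \<open>eqP\<close>, \<open>v\<close> is the image of \<open>u\<close> under
    \<open>P\<close>, so its real and imaginary parts are orthogonal to \<open>f\<close>. Division
    by \<open>k\<close> mixes the two parts, but the combinations remain orthogonal to
    \<open>f\<close>.\<close>
  define v where "v = k *s w"
  have v: "Revec v \<bullet> f = 0" "Imvec v \<bullet> f = 0"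
    unfolding v_def eqP[symmetric] Revec_cmat Imvec_cmat by (rule range_orth)+
  have w: "w = inverse k *s v" using False by (simp add: v_def vec_eq_iff)
  have Rw: "Revec w = Re (inverse k) *\<^sub>R Revec v - Im (inverse k) *\<^sub>R Imvec v"
    and Iw: "Imvec w = Re (inverse k) *\<^sub>R Imvec v + Im (inverse k) *\<^sub>R Revec v"
    unfolding w by (simp_all add: vec_eq_iff del: inverse_complex.sel)
  have w_orth: "Revec w \<bullet> f = 0" "Imvec w \<bullet> f = 0"
    unfolding Rw Iw using v by (simp_all add: inner_diff_left inner_add_left)
  have nonneg: "quad (c *\<^sub>R Q) x \<ge> 0" if "x \<bullet> f = 0" for x
    using posQ[OF _ that] by (cases "x = 0") (auto simp: quad_def)
  have cq_eq: "c * q = quad (c *\<^sub>R Q) (Revec w) + quad (c *\<^sub>R Q) (Imvec w)"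
    by (simp add: q_def distrib_left quad_c)
  have cq: "c * q \<ge> 0" unfolding cq_eq using nonneg w_orth by (simp add: add_nonneg_nonneg)
  \<comment> \<open>If \<open>z\<close> vanished, so would \<open>q\<close>; strict positivity of
    \<open>c *\<^sub>R Q\<close> would then give \<open>w = 0\<close>, and \<open>eqQ\<close> with
    \<open>k \<noteq> 0\<close> would give \<open>u = 0\<close>.\<close>
  have "z \<noteq> 0"
  proof
    assume "z = 0"
    then have "quad (c *\<^sub>R Q) (Revec w) + quad (c *\<^sub>R Q) (Imvec w) = 0"
      using q cq_eq by simp
    then have "quad (c *\<^sub>R Q) (Revec w) = 0" "quad (c *\<^sub>R Q) (Imvec w) = 0"
      using nonneg w_orth by (simp_all add: add_nonneg_eq_0_iff)
    then have "Revec w = 0" "Imvec w = 0" using posQ w_orth by (metis less_irrefl)+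
    then have "w = 0" by (simp add: vec_eq_iff complex_eq_iff)
    moreover have "(- k) *s u = 0" using \<open>w = 0\<close> eqQ by simp
    then have "u = 0" using False by (simp add: vec_eq_iff)
    ultimately show False using nz by blast
  qed
  \<comment> \<open>Only the square of \<open>c\<close> enters, so the conclusion is the same for
    either sign of \<open>c\<close>.\<close>
  have "c\<^sup>2 * (p * q) \<ge> 0" using mult_nonneg_nonneg[OF cp cq] by (simp add: power2_eq_square mult_ac)
  then have pq: "p * q \<ge> 0" using c by (simp add: zero_le_mult_iff)
  have "complex_of_real (p * q) = - k\<^sup>2 * (z * cnj z)"
    by (simp add: p q power2_eq_square)
  then have "complex_of_real (p * q) = - k\<^sup>2 * complex_of_real ((cmod z)\<^sup>2)"
    using complex_norm_square[of z] by (simp del: of_real_power)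
  then have "k\<^sup>2 = complex_of_real (- (p * q) / (cmod z)\<^sup>2)"
    using \<open>z \<noteq> 0\<close> by (simp add: field_simps)
  then show ?thesis
    by (rule Re_eq_0_if_square_nonpos) (use pq in simp)
qed simp

section \<open>Symmetry, null vector and continuity of the stability operators\<close>

lemma transpose_hopping: "transpose (hopping m \<epsilon>) = hopping m \<epsilon>"
proof -
  have "hopping m \<epsilon> $ (R, \<alpha>) $ (R', \<beta>) = hopping m \<epsilon> $ (R', \<beta>) $ (R, \<alpha>)" for R R' \<alpha> \<beta>
    by (cases \<alpha>; cases \<beta>) (auto simp: hopping_def eq_diff_eq of_bool_def)
  then show ?thesis by (auto simp: transpose_def vec_eq_iff)
qed

lemma transpose_stability_op: "transpose (stability_op \<sigma> m \<epsilon> g \<omega> \<phi>) = stability_op \<sigma> m \<epsilon> g \<omega> \<phi>"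
  using transpose_hopping[of m \<epsilon>]
  by (auto simp: transpose_def vec_eq_iff stability_op_def)

lemma stability_op_mult_vec:
  "(stability_op \<sigma> m \<epsilon> g \<omega> \<phi> *v x) $ a
    = (\<Sum>b\<in>UNIV. hopping m \<epsilon> $ a $ b * x $ b) - \<omega> * x $ a + (2 + \<sigma>) * g * (\<phi> $ a)\<^sup>2 * x $ a"
proof -
  have "(stability_op \<sigma> m \<epsilon> g \<omega> \<phi> *v x) $ a
     = (\<Sum>b\<in>UNIV. hopping m \<epsilon> $ a $ b * x $ b
         + (if a = b then - \<omega> * x $ b + (2 + \<sigma>) * g * (\<phi> $ a)\<^sup>2 * x $ b else 0))"
    unfolding matrix_vector_mult_def
    by (simp, intro sum.cong) (auto simp: stability_op_def algebra_simps)
  then show ?thesis by (simp add: sum.distrib)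
qed

text \<open>For \<sigma> = -1 the factor \<open>2 + \<sigma>\<close> equals 1, and the claim becomes
  the breather equation itself.\<close>

lemma stability_op_minus_breather:
  assumes "normalized_breather m \<epsilon> g \<omega> \<phi>"
  shows "stability_op (-1) m \<epsilon> g \<omega> \<phi> *v \<phi> = 0"
proof -
  have "(stability_op (-1) m \<epsilon> g \<omega> \<phi> *v \<phi>) $ a
      = (\<Sum>b\<in>UNIV. hopping m \<epsilon> $ a $ b * \<phi> $ b) + g * (\<phi> $ a)^3 - \<omega> * \<phi> $ a" for a
    by (simp add: stability_op_mult_vec power2_eq_square power3_eq_cube)
  then show ?thesis using assms by (simp only: vec_eq_iff normalized_breather_def) simp
qed

lemma tendsto_hopping: "((\<lambda>\<epsilon>. hopping m \<epsilon> $ a $ b) \<longlongrightarrow> hopping m t $ a $ b) (at t)"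
proof -
  have "((\<lambda>\<epsilon>. hopping m \<epsilon> $ (R, \<alpha>) $ (R', \<beta>)) \<longlongrightarrow> hopping m t $ (R, \<alpha>) $ (R', \<beta>)) (at t)"
    for R \<alpha> R' \<beta>
    unfolding hopping_def vec_lambda_beta prod.case
    by (cases \<alpha>; cases \<beta>; simp only: sublattice.case; intro tendsto_intros)
  then show ?thesis by (metis prod.exhaust)
qed

lemma isCont_stability_op:
  assumes "isCont \<phi> t" "isCont \<omega> t"
  shows "isCont (\<lambda>\<epsilon>. c *\<^sub>R stability_op \<sigma> m \<epsilon> g (\<omega> \<epsilon>) (\<phi> \<epsilon>)) t"
proof -
  have "((\<lambda>\<epsilon>. stability_op \<sigma> m \<epsilon> g (\<omega> \<epsilon>) (\<phi> \<epsilon>) $ a $ b)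
      \<longlongrightarrow> stability_op \<sigma> m t g (\<omega> t) (\<phi> t) $ a $ b) (at t)" for a b
    unfolding stability_op_def vec_lambda_beta
    by (intro tendsto_intros tendsto_hopping tendsto_vec_nth assms[unfolded continuous_at])
  then show ?thesis
    unfolding continuous_at by (intro tendsto_scaleR tendsto_const vec_tendstoI)
qed

section \<open>Positivity for the uncoupled chain\<close>

lemma sum_site: "(\<Sum>a\<in>UNIV. F (a :: 'l::nontriv site)) = (\<Sum>R\<in>UNIV. F (R, SubA) + F (R, SubB))"
proof -
  have "(\<Sum>a\<in>UNIV. F a) = (\<Sum>R\<in>UNIV. \<Sum>\<alpha>\<in>UNIV. F (R, \<alpha>))"
    unfolding UNIV_Times_UNIV[symmetric] by (simp add: sum.cartesian_product)
  then show ?thesis by (simp add: UNIV_sublattice)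
qed

text \<open>Without inter-cell hopping the form splits into one binary form per unit cell.\<close>

lemma quad_stability_op_uncoupled:
  fixes x :: "real ^ ('l::nontriv) site"
  shows "quad (stability_op \<sigma> m 0 g \<omega> \<phi>) x = (\<Sum>R\<in>UNIV.
    - 2 * m * x $ (R, SubA) * x $ (R, SubB) - \<omega> * ((x $ (R, SubA))\<^sup>2 + (x $ (R, SubB))\<^sup>2)
    + (2 + \<sigma>) * g * ((\<phi> $ (R, SubA))\<^sup>2 * (x $ (R, SubA))\<^sup>2 + (\<phi> $ (R, SubB))\<^sup>2 * (x $ (R, SubB))\<^sup>2))"
proof -
  have "(\<Sum>b\<in>UNIV. hopping m 0 $ (R, SubA) $ b * x $ b) = - m * x $ (R, SubB)" for R
    unfolding sum_site by (simp add: hopping_def of_bool_def sum_negf if_distrib if_distribR cong: if_cong)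
  moreover have "(\<Sum>b\<in>UNIV. hopping m 0 $ (R, SubB) $ b * x $ b) = - m * x $ (R, SubA)" for R
    unfolding sum_site by (simp add: hopping_def of_bool_def sum_negf if_distrib if_distribR cong: if_cong)
  ultimately show ?thesis
    unfolding quad_def inner_vec_def sum_site[of "\<lambda>a. x $ a \<bullet> _ a"] stability_op_mult_vec
    by (simp add: power2_eq_square algebra_simps)
qed

text \<open>The bound \<open>\<bar>2 * a * b\<bar> \<le> a\<^sup>2 + b\<^sup>2\<close> shows that
  the diagonal part, with weight \<open>g\<^sup>2\<close>, dominates the intra-cell coupling, with
  weight at most \<open>\<bar>g * m\<bar>\<close>.\<close>

lemma empty_cell_pos:
  fixes m g a b :: real
  assumes "\<bar>m\<bar> < \<bar>g\<bar>" "a \<noteq> 0 \<or> b \<noteq> 0"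
  shows "- g * (- 2 * m * a * b - g * (a\<^sup>2 + b\<^sup>2)) > 0"
proof -
  have ab: "a\<^sup>2 + b\<^sup>2 > 0" using assms(2) by (simp add: sum_power2_gt_zero_iff)
  have "\<bar>2 * a * b\<bar> \<le> a\<^sup>2 + b\<^sup>2"
    using sum_squares_bound[of a b] sum_squares_bound[of a "-b"] by (auto simp: abs_if)
  then have "\<bar>m * (2 * a * b)\<bar> \<le> \<bar>m\<bar> * (a\<^sup>2 + b\<^sup>2)"
    unfolding abs_mult[of m] by (rule mult_left_mono) simp
  also have "\<dots> < \<bar>g\<bar> * (a\<^sup>2 + b\<^sup>2)" using assms(1) ab by simp
  finally have "\<bar>g\<bar> * \<bar>m * (2 * a * b)\<bar> < \<bar>g\<bar> * (\<bar>g\<bar> * (a\<^sup>2 + b\<^sup>2))"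
    using assms(1) by (intro mult_strict_left_mono) auto
  then have "\<bar>g * (m * (2 * a * b))\<bar> < g * (g * (a\<^sup>2 + b\<^sup>2))"
    by (simp add: abs_mult mult.assoc[symmetric])
  then show ?thesis by (simp add: algebra_simps abs_if split: if_splits)
qed

text \<open>Within one cell the orthogonal complement of the breather is the line spanned by
  \<open>(\<phi>\<^sub>B, - \<phi>\<^sub>A)\<close>. On it the form is an explicit multiple of
  \<open>t\<^sup>2\<close>, and \<open>gap\<close> says that the factor is positive.\<close>

lemma occupied_cell_pos:
  fixes m g a b \<sigma> \<phi>\<^sub>A \<phi>\<^sub>B :: real
  assumes norm: "\<phi>\<^sub>A\<^sup>2 + \<phi>\<^sub>B\<^sup>2 = 1" and prod: "\<phi>\<^sub>A * \<phi>\<^sub>B = - m / g" and g: "g \<noteq> 0"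
    and gap: "2 * (1 + \<sigma>) * m\<^sup>2 < g\<^sup>2"
    and orth: "a * \<phi>\<^sub>A + b * \<phi>\<^sub>B = 0" and nz: "a \<noteq> 0 \<or> b \<noteq> 0"
  shows "- g * (- 2 * m * a * b - g * (a\<^sup>2 + b\<^sup>2) + (2 + \<sigma>) * g * (\<phi>\<^sub>A\<^sup>2 * a\<^sup>2 + \<phi>\<^sub>B\<^sup>2 * b\<^sup>2)) > 0"
proof -
  define t where "t = a * \<phi>\<^sub>B - b * \<phi>\<^sub>A"
  have a: "a = t * \<phi>\<^sub>B"
  proof -
    have "t * \<phi>\<^sub>B = a * (\<phi>\<^sub>A\<^sup>2 + \<phi>\<^sub>B\<^sup>2) - \<phi>\<^sub>A * (a * \<phi>\<^sub>A + b * \<phi>\<^sub>B)"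
      by (simp add: t_def algebra_simps power2_eq_square)
    then show ?thesis by (simp add: norm orth)
  qed
  have b: "b = - t * \<phi>\<^sub>A"
  proof -
    have "- t * \<phi>\<^sub>A = b * (\<phi>\<^sub>A\<^sup>2 + \<phi>\<^sub>B\<^sup>2) - \<phi>\<^sub>B * (a * \<phi>\<^sub>A + b * \<phi>\<^sub>B)"
      by (simp add: t_def algebra_simps power2_eq_square)
    then show ?thesis by (simp add: norm orth)
  qed
  have t: "t \<noteq> 0" using nz a b by auto
  have m: "m = - g * (\<phi>\<^sub>A * \<phi>\<^sub>B)" using prod g by (simp add: field_simps)
  have s: "a\<^sup>2 + b\<^sup>2 = t\<^sup>2 * (\<phi>\<^sub>A\<^sup>2 + \<phi>\<^sub>B\<^sup>2)" by (simp add: a b power_mult_distrib algebra_simps)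
  have "- g * (- 2 * m * a * b - g * (a\<^sup>2 + b\<^sup>2) + (2 + \<sigma>) * g * (\<phi>\<^sub>A\<^sup>2 * a\<^sup>2 + \<phi>\<^sub>B\<^sup>2 * b\<^sup>2))
      = t\<^sup>2 * (g\<^sup>2 - 2 * (1 + \<sigma>) * m\<^sup>2)"
    unfolding s norm unfolding a b m by (simp add: power2_eq_square algebra_simps)
  also have "\<dots> > 0" using t gap by simp
  finally show ?thesis .
qed

text \<open>The breather lives in the cell \<open>R\<^sub>0\<close>, so orthogonality to it
  constrains that cell alone. Each cell where \<open>x\<close> is nonzero contributes a positive
  term, and all other cells contribute 0.\<close>

lemma quad_stability_op_uncoupled_pos:
  fixes \<phi> x :: "real ^ ('l::nontriv) site"
  assumes "\<bar>m\<bar> < \<bar>g\<bar>" and gap: "2 * (1 + \<sigma>) * m\<^sup>2 < g\<^sup>2"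
    and norm: "\<phi>\<^sub>A\<^sup>2 + \<phi>\<^sub>B\<^sup>2 = 1" and prod: "\<phi>\<^sub>A * \<phi>\<^sub>B = - m / g"
    and \<phi>: "\<And>R \<alpha>. \<phi> $ (R, \<alpha>) = (if R = R\<^sub>0 then (case \<alpha> of SubA \<Rightarrow> \<phi>\<^sub>A | SubB \<Rightarrow> \<phi>\<^sub>B) else 0)"
    and x: "x \<noteq> 0" "x \<bullet> \<phi> = 0"
  shows "quad (- g *\<^sub>R stability_op \<sigma> m 0 g g \<phi>) x > 0"
proof -
  define T where "T R = - g * (- 2 * m * x $ (R, SubA) * x $ (R, SubB) - g * ((x $ (R, SubA))\<^sup>2 + (x $ (R, SubB))\<^sup>2)
    + (2 + \<sigma>) * g * ((\<phi> $ (R, SubA))\<^sup>2 * (x $ (R, SubA))\<^sup>2 + (\<phi> $ (R, SubB))\<^sup>2 * (x $ (R, SubB))\<^sup>2))" for R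
  have quad_T: "quad (- g *\<^sub>R stability_op \<sigma> m 0 g g \<phi>) x = (\<Sum>R\<in>UNIV. T R)"
  proof -
    have "quad (- g *\<^sub>R stability_op \<sigma> m 0 g g \<phi>) x = - g * quad (stability_op \<sigma> m 0 g g \<phi>) x"
      unfolding quad_def scaleR_matrix_vector_assoc[symmetric] by simp
    then show ?thesis unfolding quad_stability_op_uncoupled T_def sum_distrib_left .
  qed
  have "(\<Sum>R\<in>UNIV. if R = R\<^sub>0 then x $ (R, SubA) * \<phi>\<^sub>A + x $ (R, SubB) * \<phi>\<^sub>B else 0) = x \<bullet> \<phi>"
    unfolding inner_vec_def sum_site by (intro sum.cong) (auto simp: \<phi>)
  then have orth: "x $ (R\<^sub>0, SubA) * \<phi>\<^sub>A + x $ (R\<^sub>0, SubB) * \<phi>\<^sub>B = 0"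
    using x(2) by simp
  have pos: "T R > 0" if nz: "x $ (R, SubA) \<noteq> 0 \<or> x $ (R, SubB) \<noteq> 0" for R
  proof (cases "R = R\<^sub>0")
    case True
    have "g \<noteq> 0" using assms(1) by auto
    from occupied_cell_pos[OF norm prod this gap orth] nz True show ?thesis
      by (simp add: T_def \<phi>)
  next
    case False
    then show ?thesis using empty_cell_pos[OF assms(1) nz] by (simp add: T_def \<phi>)
  qed
  have nonneg: "T R \<ge> 0" for R
    using pos[of R] by (cases "x $ (R, SubA) \<noteq> 0 \<or> x $ (R, SubB) \<noteq> 0") (auto simp: T_def)
  obtain R \<alpha> where "x $ (R, \<alpha>) \<noteq> 0" using x(1) by (auto simp: vec_eq_iff)
  then have "T R > 0" using pos[of R] by (cases \<alpha>) auto
  then show ?thesis unfolding quad_T using nonneg by (intro sum_pos2[of _ R]) auto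
qed

section \<open>Linear stability near the uncoupled limit\<close>

lemma sum_UNIV_Plus:
  "(\<Sum>i\<in>UNIV. F (i :: 'a::finite + 'b::finite)) = (\<Sum>a\<in>UNIV. F (Inl a)) + (\<Sum>b\<in>UNIV. F (Inr b))"
  unfolding UNIV_Plus_UNIV[symmetric] by (subst sum.Plus) auto

text \<open>The two halves of an eigenvector solve the coupled equations of
  \<open>Re_eigenvalue_eq_0\<close>, with the breather as the null vector. The scalar
  \<open>c\<close> covers negative definite operators as well.\<close>

lemma linearly_stableI:
  assumes breather: "normalized_breather m \<epsilon> g \<omega> \<phi>" and c: "c \<noteq> 0"
    and pos_minus: "\<And>x. x \<noteq> 0 \<Longrightarrow> x \<bullet> \<phi> = 0 \<Longrightarrow> quad (c *\<^sub>R stability_op (-1) m \<epsilon> g \<omega> \<phi>) x > 0"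
    and pos_plus: "\<And>x. x \<noteq> 0 \<Longrightarrow> x \<bullet> \<phi> = 0 \<Longrightarrow> quad (c *\<^sub>R stability_op 1 m \<epsilon> g \<omega> \<phi>) x > 0"
  shows "linearly_stable m \<epsilon> g \<omega> \<phi>"
  unfolding linearly_stable_def eigenvalue_def
proof (intro allI impI, elim exE conjE)
  fix k v
  assume nz: "v \<noteq> 0" and ev: "cmat (stability_matrix m \<epsilon> g \<omega> \<phi>) *v v = k *s v"
  define u w where "u = (\<chi> a. v $ Inl a)" and "w = (\<chi> a. v $ Inr a)"
  have ev: "(\<Sum>j\<in>UNIV. complex_of_real (stability_matrix m \<epsilon> g \<omega> \<phi> $ i $ j) * v $ j) = k * v $ i" for i
    using ev by (simp add: vec_eq_iff matrix_vector_mult_def)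
  have eq_minus: "cmat (stability_op (-1) m \<epsilon> g \<omega> \<phi>) *v u = k *s w"
    using ev[of "Inr _"]
    by (simp add: vec_eq_iff matrix_vector_mult_def sum_UNIV_Plus stability_matrix_def u_def w_def)
  have eq_plus: "cmat (stability_op 1 m \<epsilon> g \<omega> \<phi>) *v w = (- k) *s u"
    using ev[of "Inl _"]
    by (simp add: vec_eq_iff matrix_vector_mult_def sum_UNIV_Plus stability_matrix_def u_def w_def
        sum_negf minus_equation_iff)
  have "u \<noteq> 0 \<or> w \<noteq> 0"
  proof (rule ccontr)
    assume "\<not> (u \<noteq> 0 \<or> w \<noteq> 0)"
    then have "v $ i = 0" for i by (cases i) (auto simp: u_def w_def vec_eq_iff)
    with nz show False by (simp add: vec_eq_iff)
  qed
  moreover have "\<phi> \<noteq> 0" using breather by (auto simp: normalized_breather_def)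
  ultimately show "Re k = 0"
    using Re_eigenvalue_eq_0[OF transpose_stability_op transpose_stability_op
        stability_op_minus_breather[OF breather] _ c pos_minus pos_plus eq_minus eq_plus]
    by blast
qed

text \<open>The radius is also taken small enough to stay inside \<open>U\<close>, where the
  breather equation is assumed.\<close>

theorem mainTheorem3:
  fixes m g \<phi>\<^sub>A \<phi>\<^sub>B :: real
    and R\<^sub>0 :: "'l::nontriv mod_ring"
    and U :: "real set"
    and \<phi> :: "real \<Rightarrow> real ^ 'l site"
    and \<omega> :: "real \<Rightarrow> real"
  assumes "m > 0" and "\<bar>g\<bar> > 2 * m"
    and "open U" and "0 \<in> U"
    and "\<And>\<epsilon>. \<epsilon> \<in> U \<Longrightarrow> normalized_breather m \<epsilon> g (\<omega> \<epsilon>) (\<phi> \<epsilon>)"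
    and "continuous_on U \<phi>" and "continuous_on U \<omega>"
    and "\<phi>\<^sub>A\<^sup>2 + \<phi>\<^sub>B\<^sup>2 = 1" and "\<phi>\<^sub>A * \<phi>\<^sub>B = - m / g"
    and "\<And>R \<alpha>. \<phi> 0 $ (R, \<alpha>) = (if R = R\<^sub>0 then (case \<alpha> of SubA \<Rightarrow> \<phi>\<^sub>A | SubB \<Rightarrow> \<phi>\<^sub>B) else 0)"
    and "\<omega> 0 = g"
  shows "\<exists>r>0. \<forall>\<epsilon>. \<bar>\<epsilon>\<bar> < r \<longrightarrow> \<epsilon> \<in> U \<and> linearly_stable m \<epsilon> g (\<omega> \<epsilon>) (\<phi> \<epsilon>)"
proof -
  have cont: "isCont \<phi> 0" "isCont \<omega> 0"
    using assms(3,4,6,7) by (simp_all add: continuous_on_eq_continuous_at)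
  have mg: "\<bar>m\<bar> < \<bar>g\<bar>" and g: "- g \<noteq> 0" using assms(1,2) by auto
  \<comment> \<open>The hypothesis \<open>\<bar>g\<bar> > 2 * m\<close> is the gap condition for
    \<sigma> = 1; for \<sigma> = -1 the condition reduces to \<open>g\<^sup>2 > 0\<close>.\<close>
  have "(2 * m)\<^sup>2 < \<bar>g\<bar>\<^sup>2" using assms(1,2) by (intro power_strict_mono) auto
  then have gap: "2 * (1 + 1) * m\<^sup>2 < g\<^sup>2" "2 * (1 + - 1) * m\<^sup>2 < g\<^sup>2"
    using g by (simp_all add: power_mult_distrib)
  \<comment> \<open>The factor \<open>- g\<close> makes the forms at \<epsilon> = 0 positive on the
    hyperplane for both signs of \<open>g\<close>.\<close>
  let ?M = "\<lambda>\<sigma> \<epsilon>. - g *\<^sub>R stability_op \<sigma> m \<epsilon> g (\<omega> \<epsilon>) (\<phi> \<epsilon>)"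
  have "\<exists>r>0. \<forall>\<epsilon>. \<bar>\<epsilon>\<bar> < r \<longrightarrow> (\<forall>x. x \<noteq> 0 \<longrightarrow> x \<bullet> \<phi> \<epsilon> = 0 \<longrightarrow> quad (?M \<sigma> \<epsilon>) x > 0)"
    if "2 * (1 + \<sigma>) * m\<^sup>2 < g\<^sup>2" for \<sigma>
  proof (rule posdef_orthogonal_compl_eventually[OF isCont_stability_op[OF cont] cont(1)])
    show "quad (?M \<sigma> 0) x > 0" if "x \<noteq> 0" "x \<bullet> \<phi> 0 = 0" for x
      using quad_stability_op_uncoupled_pos[OF mg \<open>2 * (1 + \<sigma>) * m\<^sup>2 < g\<^sup>2\<close> assms(8-10) that]
      unfolding assms(11) .
  qed
  from this[OF gap(1)] this[OF gap(2)] obtain r1 r2 where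
    r1: "r1 > 0" "\<And>\<epsilon> x. \<bar>\<epsilon>\<bar> < r1 \<Longrightarrow> x \<noteq> 0 \<Longrightarrow> x \<bullet> \<phi> \<epsilon> = 0 \<Longrightarrow> quad (?M 1 \<epsilon>) x > 0" and
    r2: "r2 > 0" "\<And>\<epsilon> x. \<bar>\<epsilon>\<bar> < r2 \<Longrightarrow> x \<noteq> 0 \<Longrightarrow> x \<bullet> \<phi> \<epsilon> = 0 \<Longrightarrow> quad (?M (-1) \<epsilon>) x > 0"
    by blast
  obtain r3 where r3: "r3 > 0" "\<And>\<epsilon>. \<bar>\<epsilon>\<bar> < r3 \<Longrightarrow> \<epsilon> \<in> U"
    using openE[OF assms(3,4)] by (metis in_mono mem_ball_0 real_norm_def)
  show ?thesis
  proof (intro exI[of _ "min r1 (min r2 r3)"] conjI allI impI)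
    fix \<epsilon> assume e: "\<bar>\<epsilon>\<bar> < min r1 (min r2 r3)"
    then show "\<epsilon> \<in> U" using r3 by simp
    then show "linearly_stable m \<epsilon> g (\<omega> \<epsilon>) (\<phi> \<epsilon>)"
      using e by (intro linearly_stableI[OF assms(5) g] r1(2) r2(2)) auto
  qed (use r1 r2 r3 in simp)
qed

end
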